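(* Let $\theta>0$ be a real number with $\theta\notin\mathbb{Q}$ and $\theta^2\in\mathbb{Q}$. Then $\theta$ is good if and only if $\theta=\lambda\sqrt{p_1\cdots p_r}$ for some rational $\lambda>0$, some integer $r\ge 1$, and distinct odd primes $p_1,\dots,p_r$, each of which is either $3$ or of the form $6k+1$ ($k$ an integer).
   Context: A positive real number $\theta$ is called "good" if, for the equilateral triangle $T$ with side length $\theta$ in the Euclidean plane, there is a point in the plane of $T$ whose distances to all three vertices of $T$ are rational numbers. *)

theory Defs
  imports "HOL-Analysis.Analysis" "HOL-Computational_Algebra.Primes"
begin

definition equilateral_triangle :: "real ^ 2 \<Rightarrow> real ^ 2 \<Rightarrow> real ^ 2 \<Rightarrow> real \<Rightarrow> bool" where
  "equilateral_triangle A B C \<theta> \<longleftrightarrow> dist A B = \<theta> \<and> dist B C = \<theta> \<and> dist C A = \<theta>"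

text \<open>The equilateral triangle of side \<open>\<theta>\<close> is unique up to an isometry of the plane, and isometries
  preserve the existence of a point at rational distances from the vertices, so it does not matter
  which such triangle is taken.\<close>

definition good :: "real \<Rightarrow> bool" where
  "good \<theta> \<longleftrightarrow> \<theta> > 0 \<and>
     (\<exists>A B C. equilateral_triangle A B C \<theta> \<and>
        (\<exists>P. dist P A \<in> \<rat> \<and> dist P B \<in> \<rat> \<and> dist P C \<in> \<rat>))"

end

theory Submission
  imports Defs "HOL-Number_Theory.Number_Theory" "HOL-Computational_Algebra.Squarefree"
begin

text \<open>
  Both sides of the equivalence say that \<open>s = \<theta>\<^sup>2\<close> is a norm \<open>x\<^sup>2 + x y + y\<^sup>2\<close> from
  the field of Eisenstein numbers \<open>\<rat>(\<omega>)\<close>.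

  The squared distances \<open>a\<close>, \<open>b\<close>, \<open>c\<close> of a point of the plane to the vertices satisfy
  \<open>s (a + b + c - s) = a\<^sup>2 + b\<^sup>2 + c\<^sup>2 - a b - b c - c a\<close>, whose right-hand side is the norm of
  \<open>a + b \<omega> + c \<omega>\<^sup>2\<close>. A prime \<open>p \<equiv> 2\<close> modulo 3 is inert, hence divides a norm to an even power;
  since \<open>a\<close>, \<open>b\<close>, \<open>c\<close> are squares, a descent shows that \<open>p\<close> also divides \<open>s\<close> to an even power.

  Conversely, if \<open>s = x\<^sup>2 + x y + y\<^sup>2\<close>, then some point of the circumcircle has the distances
  \<open>\<bar>x\<bar>\<close>, \<open>\<bar>y\<bar>\<close>, \<open>\<bar>x + y\<bar>\<close> to the vertices.
\<close>

section \<open>Distances from a point of the plane to the vertices of an equilateral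
  triangle\<close>

text \<open>Three vectors of the plane are linearly dependent, so their Gram determinant, here
  expanded along its first row, vanishes.\<close>

lemma gram_determinant_plane:
  fixes u v w :: "real ^ 2"
  shows "(u \<bullet> u) * ((v \<bullet> v) * (w \<bullet> w) - (v \<bullet> w)\<^sup>2)
    - (u \<bullet> v) * ((u \<bullet> v) * (w \<bullet> w) - (v \<bullet> w) * (u \<bullet> w))
    + (u \<bullet> w) * ((u \<bullet> v) * (v \<bullet> w) - (v \<bullet> v) * (u \<bullet> w)) = 0"
  by (simp add: inner_vec_def sum_2) Groebner_Basis.algebra

lemma equilateral_distance_relation:
  fixes A B C P :: "real ^ 2"
  assumes "equilateral_triangle A B C \<theta>" "\<theta> \<noteq> 0"
  defines "a \<equiv> (dist P A)\<^sup>2" and "b \<equiv> (dist P B)\<^sup>2" and "c \<equiv> (dist P C)\<^sup>2"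
  shows "\<theta>\<^sup>2 * (a + b + c - \<theta>\<^sup>2) = a\<^sup>2 + b\<^sup>2 + c\<^sup>2 - a * b - b * c - c * a"
proof -
  define u v w where "u = B - A" and "v = C - A" and "w = P - A"
  define s where "s = \<theta>\<^sup>2"
  have sq: "(dist X Y)\<^sup>2 = (X - Y) \<bullet> (X - Y)" for X Y :: "real ^ 2"
    by (simp add: dist_norm power2_norm_eq_inner)
  have "(dist A B)\<^sup>2 = s" "(dist B C)\<^sup>2 = s" "(dist C A)\<^sup>2 = s"
    using assms(1) by (auto simp: equilateral_triangle_def s_def)
  hence uu: "u \<bullet> u = s" and vv: "v \<bullet> v = s" and uv: "2 * (u \<bullet> v) = s"
    by (auto simp: sq u_def v_def inner_diff inner_commute)
  have ww: "w \<bullet> w = a" and uw: "2 * (u \<bullet> w) = a + s - b" and vw: "2 * (v \<bullet> w) = a + s - c"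
    using uu vv unfolding a_def b_def c_def sq
    by (auto simp: u_def v_def w_def inner_diff inner_commute)
  \<comment> \<open>This is four times the Gram determinant; a factor \<open>s\<close> remains to be
    cancelled.\<close>
  have "s * (s * (a + b + c - s) - (a\<^sup>2 + b\<^sup>2 + c\<^sup>2 - a * b - b * c - c * a)) = 0"
    using gram_determinant_plane[of u v w] uv uw vw unfolding uu vv ww by Groebner_Basis.algebra
  thus ?thesis using assms(2) by (simp add: s_def)
qed

text \<open>The point is the origin; in complex notation the vertices are \<open>l x\<close>, \<open>l y \<omega>\<close> and
  \<open>- l (x + y) \<omega>\<^sup>2\<close>.\<close>

lemma good_if_eisenstein_norm:
  fixes l x y :: real
  assumes "\<theta> > 0" "l \<in> \<rat>" "x \<in> \<rat>" "y \<in> \<rat>" "\<theta>\<^sup>2 = l\<^sup>2 * (x\<^sup>2 + x * y + y\<^sup>2)"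
  shows "good \<theta>"
proof -
  define A B C :: "real ^ 2"
    where "A = vector [l * x, 0]" and "B = vector [- l * y / 2, l * y * sqrt 3 / 2]"
      and "C = vector [l * (x + y) / 2, l * (x + y) * sqrt 3 / 2]"
  have nrm: "norm v = sqrt ((v $ 1)\<^sup>2 + (v $ 2)\<^sup>2)" for v :: "real ^ 2"
    by (simp add: norm_vec_def L2_set_def sum_2)
  have root: "r = sqrt z" if "r \<ge> 0" "r\<^sup>2 = z" for r z :: real
    using that by (simp add: real_sqrt_unique)
  have "dist A B = \<theta>" "dist B C = \<theta>" "dist C A = \<theta>"
    unfolding dist_norm nrm
    by (rule root[symmetric], use assms(1) in simp, unfold assms(5),
        simp add: A_def B_def C_def field_simps power2_eq_square)+
  moreover have "dist 0 A = \<bar>l * x\<bar>" "dist 0 B = \<bar>l * y\<bar>" "dist 0 C = \<bar>l * (x + y)\<bar>"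
    unfolding dist_norm nrm
    by (rule root[symmetric], simp, unfold power2_abs,
        simp add: A_def B_def C_def field_simps power2_eq_square)+
  moreover have "\<bar>l * x\<bar> \<in> \<rat>" "\<bar>l * y\<bar> \<in> \<rat>" "\<bar>l * (x + y)\<bar> \<in> \<rat>"
    using assms by auto
  ultimately show ?thesis
    using assms(1) unfolding good_def equilateral_triangle_def by metis
qed

section \<open>Inert primes and Eisenstein norms\<close>

text \<open>As 3 is coprime to \<open>p - 1\<close>, cubing is injective modulo \<open>p\<close>. A
  norm divisible by \<open>p\<close> gives \<open>x ^ 3 = y ^ 3\<close>, hence \<open>x = y\<close>,
  modulo \<open>p\<close>, and the norm becomes \<open>3 * y ^ 2\<close>.\<close>

lemma prime_dvd_eisenstein_norm:
  fixes x y :: int and p :: nat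
  assumes p: "prime p" "p mod 3 = 2" and dvd: "int p dvd x\<^sup>2 + x * y + y\<^sup>2"
  shows "int p dvd x \<and> int p dvd y"
proof -
  have aux: "int p dvd u" if d: "int p dvd u\<^sup>2 + u * v + v\<^sup>2" for u v :: int
  proof (rule ccontr)
    assume nu: "\<not> int p dvd u"
    have nv: "\<not> int p dvd v"
    proof
      assume "int p dvd v"
      hence "int p dvd (u\<^sup>2 + u * v + v\<^sup>2) - v * (u + v)"
        using d by (intro dvd_diff) auto
      also have "(u\<^sup>2 + u * v + v\<^sup>2) - v * (u + v) = u\<^sup>2"
        by (simp add: algebra_simps power2_eq_square)
      finally show False using nu p(1) by (auto simp: prime_dvd_power_iff)
    qed
    define k where "k = p div 3"
    \<comment> \<open>With this exponent Fermat's theorem makes \<open>t ^ (3 * k)\<close>, a power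
      of the cube of \<open>t\<close>, the inverse of \<open>t\<close>.\<close>
    have pk: "p - 1 = 3 * k + 1" using p(2) unfolding k_def by presburger
    have fermat: "[t ^ (3 * k + 1) = 1] (mod int p)" if "\<not> int p dvd t" for t :: int
    proof -
      have p0: "int p > 0" using p(1) prime_gt_0_nat by simp
      define n where "n = nat (t mod int p)"
      have n: "int n = t mod int p" using p0 by (simp add: n_def)
      hence "\<not> p dvd n" using that by (metis dvd_mod_iff dvd_refl int_dvd_int_iff)
      hence "[n ^ (p - 1) = 1] (mod p)" using p(1) by (rule fermat_theorem[rotated])
      hence "[int n ^ (p - 1) = 1] (mod int p)"
        by (metis cong_int_iff of_nat_1 of_nat_power)
      thus ?thesis unfolding n pk by (simp only: cong_def power_mod)
    qed
    have "u ^ 3 - v ^ 3 = (u - v) * (u\<^sup>2 + u * v + v\<^sup>2)" by Groebner_Basis.algebra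
    hence "[u ^ 3 = v ^ 3] (mod int p)"
      using d by (simp add: cong_iff_dvd_diff)
    hence cub: "[u ^ (3 * k) = v ^ (3 * k)] (mod int p)"
      by (simp add: power_mult cong_pow)
    have "[u * u ^ (3 * k) = v * v ^ (3 * k)] (mod int p)"
      using fermat[OF nu] cong_sym[OF fermat[OF nv]] by (auto intro: cong_trans)
    hence "[u * u ^ (3 * k) = v * u ^ (3 * k)] (mod int p)"
      using cub by (meson cong_refl cong_mult cong_sym cong_trans)
    moreover have "coprime (u ^ (3 * k)) (int p)"
      using nu p(1) prime_imp_coprime[of "int p" u] by (simp add: coprime_commute)
    ultimately have "[u = v] (mod int p)" by (simp add: cong_mult_rcancel)
    hence "int p dvd u - v" by (simp add: cong_iff_dvd_diff)
    hence "int p dvd (u\<^sup>2 + u * v + v\<^sup>2) - (u - v) * (u + 2 * v)"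
      using d by (intro dvd_diff) auto
    also have "(u\<^sup>2 + u * v + v\<^sup>2) - (u - v) * (u + 2 * v) = 3 * v\<^sup>2" by Groebner_Basis.algebra
    finally have "int p dvd 3" using nv p(1)
      by (auto simp: prime_dvd_mult_iff prime_dvd_power_iff)
    hence "p dvd 3" by presburger
    hence "p = 3" using p(1) by (simp add: primes_dvd_imp_eq)
    thus False using p(2) by simp
  qed
  show ?thesis using aux[of x y] aux[of y x] dvd by (simp add: algebra_simps)
qed

text \<open>Descent: if \<open>p\<close> divides a nonzero norm, it divides both arguments, and
  dividing them by \<open>p\<close> removes exactly two factors \<open>p\<close>.\<close>

lemma even_multiplicity_eisenstein_norm:
  fixes x y :: int and p :: nat
  assumes p: "prime p" "p mod 3 = 2"
  shows "even (multiplicity (int p) (x\<^sup>2 + x * y + y\<^sup>2))"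
proof (induction "nat \<bar>x\<bar> + nat \<bar>y\<bar>" arbitrary: x y rule: less_induct)
  case less
  let ?n = "x\<^sup>2 + x * y + y\<^sup>2"
  show ?case
  proof (cases "int p dvd ?n \<and> ?n \<noteq> 0")
    case False
    \<comment> \<open>For the norm 0 the \<open>multiplicity\<close> is 0 by convention, hence
      even.\<close>
    thus ?thesis by (auto simp: not_dvd_imp_multiplicity_0)
  next
    case True
    then obtain u v where uv: "x = int p * u" "y = int p * v"
      using prime_dvd_eisenstein_norm[OF p, of x y] by (auto elim!: dvdE)
    have p2: "int p \<ge> 2" using p(1) prime_ge_2_nat by force
    have le: "nat \<bar>t\<bar> \<le> nat \<bar>int p * t\<bar>" "t \<noteq> 0 \<Longrightarrow> nat \<bar>t\<bar> < nat \<bar>int p * t\<bar>" for t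
      using p2 by (auto simp: abs_mult nat_mult_distrib nat_abs_mult_distrib)
    have "u \<noteq> 0 \<or> v \<noteq> 0" using True uv by auto
    hence "nat \<bar>u\<bar> + nat \<bar>v\<bar> < nat \<bar>x\<bar> + nat \<bar>y\<bar>"
      unfolding uv using le(1)[of u] le(1)[of v] le(2)[of u] le(2)[of v] by linarith
    hence ev: "even (multiplicity (int p) (u\<^sup>2 + u * v + v\<^sup>2))" by (rule less)
    have eq: "?n = int p ^ 2 * (u\<^sup>2 + u * v + v\<^sup>2)" unfolding uv by Groebner_Basis.algebra
    have "multiplicity (int p) ?n = 2 + multiplicity (int p) (u\<^sup>2 + u * v + v\<^sup>2)"
      unfolding eq using True p(1) eq
      by (subst prime_elem_multiplicity_mult_distrib)
         (auto simp: prime_elem_multiplicity_power_distrib)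
    thus ?thesis using ev by simp
  qed
qed

text \<open>If \<open>p\<close> divides \<open>s\<close> to an odd power, both factors on the left are divisible by \<open>p\<close>,
  which forces \<open>p\<close> to divide \<open>a\<close>, \<open>b\<close>, \<open>c\<close> and \<open>p\<^sup>2\<close> to divide \<open>s\<close>: infinite descent.\<close>

lemma even_multiplicity_side_square:
  fixes a b c s :: int and p :: nat
  assumes p: "prime p" "p mod 3 = 2" and "s \<noteq> 0"
    and "s * (a\<^sup>2 + b\<^sup>2 + c\<^sup>2 - s) =
      (a\<^sup>2)\<^sup>2 + (b\<^sup>2)\<^sup>2 + (c\<^sup>2)\<^sup>2 - a\<^sup>2 * b\<^sup>2 - b\<^sup>2 * c\<^sup>2 - c\<^sup>2 * a\<^sup>2"
  shows "even (multiplicity (int p) s)"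
  using assms(3,4)
proof (induction "multiplicity (int p) s" arbitrary: a b c s rule: less_induct)
  case less
  note eq = less.prems(2)
  define q where "q = int p"
  have q: "prime q" using p(1) by (simp add: q_def)
  have q0: "q \<noteq> 0" using q by auto
  have q3: "\<not> q dvd 3"
  proof
    assume "q dvd 3"
    hence "p dvd 3" unfolding q_def by presburger
    hence "p = 3" using p(1) by (simp add: primes_dvd_imp_eq)
    thus False using p(2) by simp
  qed
  define x y where "x = a\<^sup>2 - b\<^sup>2" and "y = b\<^sup>2 - c\<^sup>2"
  define t where "t = a\<^sup>2 + b\<^sup>2 + c\<^sup>2 - s"
  have st: "s * t = x\<^sup>2 + x * y + y\<^sup>2" using eq unfolding x_def y_def t_def by Groebner_Basis.algebra
  show ?case
  proof (rule ccontr)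
    assume "\<not> even (multiplicity (int p) s)"
    hence odd: "odd (multiplicity q s)" by (simp add: q_def)
    hence qs: "q dvd s" by (metis even_zero not_dvd_imp_multiplicity_0)
    hence "q dvd x \<and> q dvd y"
      using prime_dvd_eisenstein_norm[OF p, of x y] by (simp add: q_def flip: st)
    \<comment> \<open>The norm \<open>s * t\<close> contains \<open>q\<close> to an even power and
      \<open>s\<close> to an odd one, so a nonzero \<open>t\<close> also contains \<open>q\<close>
      to an odd power.\<close>
    have "q dvd t"
    proof (cases "t = 0")
      case False
      have "even (multiplicity q s + multiplicity q t)"
        using even_multiplicity_eisenstein_norm[OF p, of x y]
          prime_elem_multiplicity_mult_distrib[of q s t] less.prems(1) False q
        unfolding q_def[symmetric] st[symmetric] by auto
      thus ?thesis using odd by (metis even_add even_zero not_dvd_imp_multiplicity_0)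
    qed auto
    \<comment> \<open>The sum of the three squares is \<open>s + t\<close> and their differences
      come from \<open>x\<close> and \<open>y\<close>, so each square is determined up to the factor
      3, which is invertible modulo \<open>q\<close>.\<close>
    have "q dvd 3 * a\<^sup>2" "q dvd 3 * b\<^sup>2" "q dvd 3 * c\<^sup>2"
    proof -
      have "3 * a\<^sup>2 = s + t + 2 * x + y" "3 * b\<^sup>2 = s + t - x + y" "3 * c\<^sup>2 = s + t - x - 2 * y"
        unfolding x_def y_def t_def by auto
      thus "q dvd 3 * a\<^sup>2" "q dvd 3 * b\<^sup>2" "q dvd 3 * c\<^sup>2"
        using qs \<open>q dvd t\<close> \<open>q dvd x \<and> q dvd y\<close> by auto
    qed
    hence "q dvd a" "q dvd b" "q dvd c"
      using q q3 by (auto simp: prime_dvd_mult_iff prime_dvd_power_iff)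
    then obtain a' b' c' where abc: "a = q * a'" "b = q * b'" "c = q * c'"
      by (auto elim!: dvdE)
    have "q\<^sup>2 dvd s"
    proof -
      obtain s1 where s1: "s = q * s1" using qs by auto
      \<comment> \<open>The square of \<open>s\<close> is isolated; every other term of the equation
        is divisible by \<open>q ^ 3\<close>.\<close>
      have "q\<^sup>2 * s1\<^sup>2 = q\<^sup>2 * (q * (s1 * (a'\<^sup>2 + b'\<^sup>2 + c'\<^sup>2)
          - q * ((a'\<^sup>2)\<^sup>2 + (b'\<^sup>2)\<^sup>2 + (c'\<^sup>2)\<^sup>2 - a'\<^sup>2 * b'\<^sup>2 - b'\<^sup>2 * c'\<^sup>2 - c'\<^sup>2 * a'\<^sup>2)))"
        using eq unfolding s1 abc by Groebner_Basis.algebra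
      hence "q dvd s1\<^sup>2" using q0 by simp
      hence "q dvd s1" using q by (auto simp: prime_dvd_power_iff)
      thus ?thesis unfolding s1 power2_eq_square by auto
    qed
    then obtain s' where s': "s = q\<^sup>2 * s'" by auto
    have s'0: "s' \<noteq> 0" using s' less.prems(1) by auto
    have mult: "multiplicity q s = 2 + multiplicity q s'"
      unfolding s' using q s'0 q0
      by (subst prime_elem_multiplicity_mult_distrib)
         (auto simp: prime_elem_multiplicity_power_distrib)
    \<comment> \<open>The equation is homogeneous if \<open>s\<close> has weight 2 and
      \<open>a\<close>, \<open>b\<close>, \<open>c\<close> have weight 1, so the quotients satisfy
      it again.\<close>
    have "q ^ 4 * (s' * (a'\<^sup>2 + b'\<^sup>2 + c'\<^sup>2 - s')) = q ^ 4 * (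
      (a'\<^sup>2)\<^sup>2 + (b'\<^sup>2)\<^sup>2 + (c'\<^sup>2)\<^sup>2 - a'\<^sup>2 * b'\<^sup>2 - b'\<^sup>2 * c'\<^sup>2 - c'\<^sup>2 * a'\<^sup>2)"
      using eq unfolding s' abc by Groebner_Basis.algebra
    hence "s' * (a'\<^sup>2 + b'\<^sup>2 + c'\<^sup>2 - s') =
      (a'\<^sup>2)\<^sup>2 + (b'\<^sup>2)\<^sup>2 + (c'\<^sup>2)\<^sup>2 - a'\<^sup>2 * b'\<^sup>2 - b'\<^sup>2 * c'\<^sup>2 - c'\<^sup>2 * a'\<^sup>2"
      using q0 by simp
    from less.hyps[OF _ s'0 this] mult odd show False by (simp add: q_def)
  qed
qed

section \<open>Norm representations of primes congruent to 1 modulo 3\<close>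

text \<open>Thue's lemma: the more than \<open>p\<close> pairs with entries from 0 to the integer
  part of the root of \<open>p\<close> cannot all give different residues; two colliding pairs are
  subtracted.\<close>

lemma thue_congruence:
  fixes w :: int and p :: nat
  assumes "prime p"
  obtains x y :: int where "int p dvd x - w * y" "x\<^sup>2 < int p" "y\<^sup>2 < int p" "x \<noteq> 0 \<or> y \<noteq> 0"
proof -
  define k where "k = floor_sqrt p"
  have p0: "p > 0" using assms prime_gt_0_nat by blast
  \<comment> \<open>Strict because a prime is not a square.\<close>
  have kp: "k\<^sup>2 < p"
  proof -
    have "k\<^sup>2 \<noteq> p" using assms by (auto simp: prime_power_iff)
    thus ?thesis using floor_sqrt_power2_le[of p] unfolding k_def by linarith
  qed
  have pk: "p < (k + 1)\<^sup>2" using Suc_floor_sqrt_power2_gt[of p] by (simp add: k_def)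
  define f where "f = (\<lambda>(i, j). (int i - w * int j) mod int p)"
  let ?S = "{..k} \<times> {..k}"
  have "f ` ?S \<subseteq> {0..<int p}" using p0 by (auto simp: f_def)
  hence "card (f ` ?S) \<le> p" using card_mono[of "{0..<int p}" "f ` ?S"] by simp
  also have "p < card ?S" using pk by (simp add: power2_eq_square)
  finally have "\<not> inj_on f ?S" using pigeonhole by blast
  then obtain i j i' j' where ij: "i \<le> k" "j \<le> k" "i' \<le> k" "j' \<le> k"
      "(i, j) \<noteq> (i', j')" "f (i, j) = f (i', j')"
    unfolding inj_on_def by auto
  have bound: "(int m - int n)\<^sup>2 < int p" if "m \<le> k" "n \<le> k" for m n
  proof -
    have "\<bar>int m - int n\<bar> \<le> int k" using that by auto
    hence "(int m - int n)\<^sup>2 \<le> (int k)\<^sup>2" using abs_le_square_iff[of "int m - int n" "int k"] by simp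
    also have "\<dots> < int p" using kp by (metis of_nat_less_iff of_nat_power)
    finally show ?thesis .
  qed
  have "int p dvd (int i - w * int j) - (int i' - w * int j')"
    using ij(6) by (simp add: f_def mod_eq_dvd_iff)
  hence "int p dvd (int i - int i') - w * (int j - int j')" by (simp add: algebra_simps)
  from that[OF this bound bound] ij show thesis by auto
qed

text \<open>A primitive root raised to the power \<open>(p - 1) / 3\<close> has order 3, so it is a
  root of \<open>w ^ 3 - 1\<close> but not of \<open>w - 1\<close>.\<close>

lemma primitive_cube_root_mod_prime:
  fixes p :: nat
  assumes "prime p" "p mod 3 = 1"
  obtains w :: int where "int p dvd w\<^sup>2 + w + 1"
proof -
  obtain g where g: "residue_primroot p g"
    using prime_primitive_root_exists[OF prime_gt_1_nat] assms(1) by auto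
  hence og: "ord p g = p - 1" using assms(1) by (auto simp: residue_primroot_def totient_prime)
  define k where "k = p div 3"
  have pk: "p - 1 = k * 3" unfolding k_def using assms(2) by presburger
  have "p > 1" using assms(1) prime_gt_1_nat by blast
  hence k: "0 < k" "k < ord p g" using og pk by auto
  define w where "w = int g ^ k"
  have "[(g ^ k) ^ 3 = 1] (mod p)" using ord[of g p] og pk by (simp add: power_mult)
  hence "[w ^ 3 = 1] (mod int p)" unfolding w_def by (metis cong_int_iff of_nat_1 of_nat_power)
  hence "int p dvd w ^ 3 - 1" by (simp add: cong_iff_dvd_diff)
  also have "w ^ 3 - 1 = (w - 1) * (w\<^sup>2 + w + 1)" by Groebner_Basis.algebra
  finally have "int p dvd w - 1 \<or> int p dvd w\<^sup>2 + w + 1"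
    using assms(1) by (simp add: prime_dvd_mult_iff)
  moreover have "\<not> int p dvd w - 1"
  proof
    assume "int p dvd w - 1"
    hence "[w = 1] (mod int p)" by (simp add: cong_iff_dvd_diff)
    hence "[g ^ k = 1] (mod p)" unfolding w_def by (metis cong_int_iff of_nat_1 of_nat_power)
    thus False using k by (metis dvd_imp_le ord_divides not_less)
  qed
  ultimately show thesis using that by blast
qed

text \<open>Thue's lemma for a cube root of unity \<open>w\<close> yields a norm that is a multiple
  of \<open>p\<close> strictly between 0 and \<open>3 * p\<close>. The value \<open>2 * p\<close>
  fails because even norms are divisible by 4.\<close>

lemma prime_eisenstein_norm:
  fixes p :: nat
  assumes "prime p" "p mod 3 = 1"
  obtains x y :: int where "int p = x\<^sup>2 + x * y + y\<^sup>2"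
proof -
  obtain w where w: "int p dvd w\<^sup>2 + w + 1"
    using primitive_cube_root_mod_prime[OF assms] .
  obtain x y where xy: "int p dvd x - w * y" "x\<^sup>2 < int p" "y\<^sup>2 < int p" "x \<noteq> 0 \<or> y \<noteq> 0"
    using thue_congruence[OF assms(1)] .
  define n where "n = x\<^sup>2 + x * y + y\<^sup>2"
  \<comment> \<open>Modulo \<open>p\<close> the form splits as
    \<open>(x - w * y) * (x - w ^ 2 * y)\<close>, where \<open>- w ^ 2\<close> is replaced by
    \<open>w + 1\<close>.\<close>
  have "n = (x - w * y) * (x + w * y + y) + (w\<^sup>2 + w + 1) * y\<^sup>2"
    unfolding n_def by Groebner_Basis.algebra
  hence "int p dvd n" using xy(1) w by auto
  then obtain m where m: "n = int p * m" by auto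
  have p0: "int p > 0" using xy(2) by (smt (verit) zero_le_power2)
  have "4 * n = (2 * x + y)\<^sup>2 + 3 * y\<^sup>2" "4 * n = (x + 2 * y)\<^sup>2 + 3 * x\<^sup>2"
    unfolding n_def by Groebner_Basis.algebra+
  hence "n > 0" using xy(4) by (smt (verit) zero_le_power2 zero_less_power2)
  hence "m > 0" using m p0 by (simp add: zero_less_mult_iff)
  have "2 * n = 3 * x\<^sup>2 + 3 * y\<^sup>2 - (x - y)\<^sup>2" unfolding n_def by Groebner_Basis.algebra
  hence "n < int p * 3" using xy(2,3) by (smt (verit) zero_le_power2)
  hence "m < 3" using m p0 by simp
  have "m \<noteq> 2"
  proof
    assume m2: "m = 2"
    hence "even n" using m by simp
    hence "even x" "even y" unfolding n_def by (auto simp: even_add)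
    then obtain x' y' where "x = 2 * x'" "y = 2 * y'" by (auto elim!: evenE)
    hence "n = 4 * (x'\<^sup>2 + x' * y' + y'\<^sup>2)" unfolding n_def by Groebner_Basis.algebra
    hence "int p = 2 * (x'\<^sup>2 + x' * y' + y'\<^sup>2)" using m m2 by simp
    hence "even (int p)" by simp
    hence "p = 2" using assms(1) primes_dvd_imp_eq[OF two_is_prime_nat, of p] by simp
    thus False using assms(2) by simp
  qed
  hence "m = 1" using \<open>m > 0\<close> \<open>m < 3\<close> by linarith
  hence "n = int p" using m by simp
  thus thesis using that unfolding n_def by metis
qed

lemma prod_eisenstein_norm:
  fixes f :: "'a \<Rightarrow> int"
  assumes "finite I" "\<And>i. i \<in> I \<Longrightarrow> \<exists>x y. f i = x\<^sup>2 + x * y + y\<^sup>2"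
  shows "\<exists>x y. (\<Prod>i\<in>I. f i) = x\<^sup>2 + x * y + y\<^sup>2"
  using assms
proof (induction I rule: finite_induct)
  case empty
  show ?case by (rule exI[of _ 1], rule exI[of _ 0]) simp
next
  case (insert i I)
  obtain x y u v where xy: "f i = x\<^sup>2 + x * y + y\<^sup>2" and uv: "(\<Prod>i\<in>I. f i) = u\<^sup>2 + u * v + v\<^sup>2"
    using insert by (metis insertCI)
  have "(\<Prod>i\<in>insert i I. f i) = (x\<^sup>2 + x * y + y\<^sup>2) * (u\<^sup>2 + u * v + v\<^sup>2)"
    using insert xy uv by simp
  \<comment> \<open>The new arguments are the coordinates of
    \<open>(x - y * \<omega>) * (u - v * \<omega>)\<close>, reduced by
    \<open>\<omega> ^ 2 = - 1 - \<omega>\<close>.\<close>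
  also have "\<dots> = (x * u - y * v)\<^sup>2 + (x * u - y * v) * (x * v + y * u + y * v)
      + (x * v + y * u + y * v)\<^sup>2"
    by Groebner_Basis.algebra
  finally show ?case by blast
qed

section \<open>Clearing denominators and extracting squarefree parts\<close>

lemma squarefree_nat_prod_primes:
  fixes n :: nat
  assumes "squarefree n"
  shows "n = \<Prod>(prime_factors n)"
proof -
  have "n \<noteq> 0" using assms by (metis not_squarefree_0)
  hence "n = (\<Prod>p\<in>prime_factors n. p ^ multiplicity p n)" by (simp add: prime_factorization_nat)
  also have "\<dots> = \<Prod>(prime_factors n)"
    using assms squarefree_factorial_semiring'[OF \<open>n \<noteq> 0\<close>]
    by (intro prod.cong) auto
  finally show ?thesis .
qed

lemma common_denominator:
  fixes X :: "real set"
  assumes "finite X" "X \<subseteq> \<rat>"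
  shows "\<exists>d::nat. d > 0 \<and> (\<forall>x\<in>X. real d * x \<in> \<int>)"
  using assms
proof (induction X rule: finite_induct)
  case empty
  show ?case by auto
next
  case (insert x X)
  then obtain d :: nat where d: "d > 0" "\<forall>x\<in>X. real d * x \<in> \<int>" by auto
  obtain m n where x: "x = real_of_int m / real_of_int n" "n > 0"
    using insert.prems by (auto elim: Rats_cases')
  define e where "e = nat n"
  have e: "x = real_of_int m / real e" "e > 0" using x by (auto simp: e_def)
  have "real (d * e) * x = of_int (int d * m)" using e by simp
  moreover have "real (d * e) * z \<in> \<int>" if "z \<in> X" for z
  proof -
    have "real (d * e) * z = of_int (int e) * (real d * z)" by simp
    thus ?thesis using d(2) that by (metis Ints_mult Ints_of_int)
  qed
  ultimately show ?case using d(1) e(2)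
    by (intro exI[of _ "d * e"]) (metis Ints_of_int insert_iff mult_pos_pos)
qed

text \<open>Scaling by a common denominator gives an integer solution of the distance relation.
  Primes congruent to 2 modulo 3 occur in the scaled \<open>\<theta> ^ 2\<close> to even powers, so
  they are absent from its squarefree part \<open>m\<close>.\<close>

lemma good_imp_eisenstein_primes:
  fixes \<theta> :: real
  assumes "good \<theta>" and "\<theta>\<^sup>2 \<in> \<rat>"
  obtains l :: real and m :: nat where "l \<in> \<rat>" "l > 0" "squarefree m" "\<theta> = l * sqrt (real m)"
    "\<And>p. p \<in> prime_factors m \<Longrightarrow> p mod 3 \<noteq> 2"
proof -
  obtain A B C P :: "real ^ 2" where th: "\<theta> > 0" and tri: "equilateral_triangle A B C \<theta>"
    and rat: "dist P A \<in> \<rat>" "dist P B \<in> \<rat>" "dist P C \<in> \<rat>"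
    using assms(1) unfolding good_def by blast
  obtain d :: nat where d: "d > 0" and
    dint: "\<forall>x\<in>{\<theta>\<^sup>2, dist P A, dist P B, dist P C}. real d * x \<in> \<int>"
    using common_denominator[of "{\<theta>\<^sup>2, dist P A, dist P B, dist P C}"] rat assms(2) by auto
  obtain a b c t :: int where abc: "real d * dist P A = of_int a" "real d * dist P B = of_int b"
    "real d * dist P C = of_int c" "real d * \<theta>\<^sup>2 = of_int t"
    using dint by (auto elim!: Ints_cases)
  \<comment> \<open>The distances are scaled by \<open>d\<close>, so the squared side must be scaled
    by \<open>d ^ 2\<close>, although \<open>d\<close> alone makes it integral.\<close>
  define s where "s = int d * t"
  have s: "(real d)\<^sup>2 * \<theta>\<^sup>2 = of_int s"
    unfolding s_def using abc(4) by (simp add: power2_eq_square)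
  have "of_int (s * (a\<^sup>2 + b\<^sup>2 + c\<^sup>2 - s)) = (of_int (
      (a\<^sup>2)\<^sup>2 + (b\<^sup>2)\<^sup>2 + (c\<^sup>2)\<^sup>2 - a\<^sup>2 * b\<^sup>2 - b\<^sup>2 * c\<^sup>2 - c\<^sup>2 * a\<^sup>2) :: real)"
    using equilateral_distance_relation[OF tri less_imp_neq[OF th, symmetric], of P]
    unfolding of_int_mult of_int_add of_int_diff of_int_power abc[symmetric] s[symmetric]
    by Groebner_Basis.algebra
  hence eq: "s * (a\<^sup>2 + b\<^sup>2 + c\<^sup>2 - s) =
      (a\<^sup>2)\<^sup>2 + (b\<^sup>2)\<^sup>2 + (c\<^sup>2)\<^sup>2 - a\<^sup>2 * b\<^sup>2 - b\<^sup>2 * c\<^sup>2 - c\<^sup>2 * a\<^sup>2"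
    by (simp only: of_int_eq_iff)
  have "real_of_int s > 0" using d th by (simp flip: s)
  hence s0: "s > 0" by simp
  define n where "n = nat s"
  have n: "int n = s" "n > 0" using s0 by (auto simp: n_def)
  define l m where "l = real (square_part n) / real d" and "m = squarefree_part n"
  have "n = m * square_part n ^ 2" unfolding m_def by (rule squarefree_decompose)
  hence "real n = real m * real (square_part n) ^ 2" by (metis of_nat_mult of_nat_power)
  hence "(real d)\<^sup>2 * \<theta>\<^sup>2 = real m * real (square_part n) ^ 2"
    using s n(1) by (metis of_int_of_nat_eq)
  hence sq: "\<theta>\<^sup>2 = l\<^sup>2 * real m" unfolding l_def using d by (simp add: field_simps)
  have l: "l > 0" "l \<in> \<rat>"
    using d n(2) square_part_0_iff[of n] by (auto simp: l_def simp del: square_part_0_iff)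
  show thesis
  proof (rule that[OF l(2,1)])
    show "squarefree m" by (simp add: m_def)
    have "\<theta> = sqrt (\<theta>\<^sup>2)" using th by simp
    also have "\<dots> = l * sqrt (real m)" unfolding sq using l by (simp add: real_sqrt_mult)
    finally show "\<theta> = l * sqrt (real m)" .
    fix p assume pm: "p \<in> prime_factors m"
    hence p: "prime p" by auto
    show "p mod 3 \<noteq> 2"
    proof
      assume "p mod 3 = 2"
      from even_multiplicity_side_square[OF p this _ eq] s0
      have "even (multiplicity (int p) (int n))" using n by simp
      moreover have "{k. int p ^ k dvd int n} = {k. p ^ k dvd n}"
        by (metis int_dvd_int_iff of_nat_power)
      ultimately have "even (multiplicity p n)" by (simp only: multiplicity_def)
      hence "multiplicity p m = 0" using p unfolding m_def
        by (simp add: prime_multiplicity_squarefree_part)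
      thus False using pm by (simp add: prime_factors_multiplicity)
    qed
  qed
qed

section \<open>Radicands composed of 3 and primes of the form 6k+1\<close>

lemma prime_mod_three_cases:
  fixes p :: nat
  assumes "prime p" "p mod 3 \<noteq> 2"
  shows "odd p \<and> (p = 3 \<or> (\<exists>k::int. int p = 6 * k + 1))"
proof -
  have "odd p"
  proof
    assume "even p"
    hence "p = 2" using assms(1) primes_dvd_imp_eq[OF two_is_prime_nat, of p] by simp
    thus False using assms(2) by simp
  qed
  moreover have "p = 3" if "3 dvd p"
    using that assms(1) primes_dvd_imp_eq[of 3 p] by simp
  ultimately show ?thesis using assms(2) by presburger
qed

theorem theorem1:
  fixes \<theta> :: real
  assumes "\<theta> > 0" and "\<theta> \<notin> \<rat>" and "\<theta>\<^sup>2 \<in> \<rat>"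
  shows "good \<theta> \<longleftrightarrow>
    (\<exists>(l::real) (r::nat) (p :: nat \<Rightarrow> nat).
        l \<in> \<rat> \<and> l > 0 \<and> r \<ge> 1 \<and> inj_on p {1..r} \<and>
        (\<forall>i\<in>{1..r}. prime (p i) \<and> odd (p i) \<and> (p i = 3 \<or> (\<exists>k::int. int (p i) = 6 * k + 1))) \<and>
        \<theta> = l * sqrt (real (\<Prod>i=1..r. p i)))"
proof
  assume "good \<theta>"
  then obtain l m where lm: "l \<in> \<rat>" "l > 0" "squarefree m" "\<theta> = l * sqrt (real m)"
    "\<And>p. p \<in> prime_factors m \<Longrightarrow> p mod 3 \<noteq> 2"
    using good_imp_eisenstein_primes assms(3) by metis
  obtain p where p: "bij_betw p {1..card (prime_factors m)} (prime_factors m)"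
    using ex_bij_betw_nat_finite_1[of "prime_factors m"] by auto
  have prod: "(\<Prod>i=1..card (prime_factors m). p i) = m"
    using prod.reindex_bij_betw[OF p, of id] squarefree_nat_prod_primes[OF lm(3)] by simp
  \<comment> \<open>Irrationality of \<open>\<theta>\<close> enters here: it guarantees at least one
    prime under the root.\<close>
  have "m \<noteq> 1" using lm(1,4) assms(2) by auto
  hence "card (prime_factors m) \<ge> 1" using prod by (cases "card (prime_factors m)") auto
  moreover have "prime (p i) \<and> odd (p i) \<and> (p i = 3 \<or> (\<exists>k::int. int (p i) = 6 * k + 1))"
    if "i \<in> {1..card (prime_factors m)}" for i
  proof -
    have "p i \<in> prime_factors m" using p that by (auto simp: bij_betw_def)
    thus ?thesis using lm(5) prime_mod_three_cases by blast
  qed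
  ultimately show "\<exists>(l::real) (r::nat) (p :: nat \<Rightarrow> nat).
        l \<in> \<rat> \<and> l > 0 \<and> r \<ge> 1 \<and> inj_on p {1..r} \<and>
        (\<forall>i\<in>{1..r}. prime (p i) \<and> odd (p i) \<and> (p i = 3 \<or> (\<exists>k::int. int (p i) = 6 * k + 1))) \<and>
        \<theta> = l * sqrt (real (\<Prod>i=1..r. p i))"
    using lm(1,2,4) p by (intro exI[of _ l] exI[of _ "card (prime_factors m)"] exI[of _ p])
      (auto simp: prod bij_betw_def simp del: of_nat_prod One_nat_def)
next
  assume "\<exists>(l::real) (r::nat) (p :: nat \<Rightarrow> nat).
        l \<in> \<rat> \<and> l > 0 \<and> r \<ge> 1 \<and> inj_on p {1..r} \<and>
        (\<forall>i\<in>{1..r}. prime (p i) \<and> odd (p i) \<and> (p i = 3 \<or> (\<exists>k::int. int (p i) = 6 * k + 1))) \<and>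
        \<theta> = l * sqrt (real (\<Prod>i=1..r. p i))"
  then obtain l :: real and r :: nat and p :: "nat \<Rightarrow> nat" where l: "l \<in> \<rat>"
    and p: "\<And>i. i \<in> {1..r} \<Longrightarrow> prime (p i) \<and> (p i = 3 \<or> (\<exists>k::int. int (p i) = 6 * k + 1))"
    and th: "\<theta> = l * sqrt (real (\<Prod>i=1..r. p i))"
    by blast
  have "\<exists>x y. int (p i) = x\<^sup>2 + x * y + y\<^sup>2" if i: "i \<in> {1..r}" for i
  proof (cases "p i = 3")
    case True
    \<comment> \<open>The ramified prime 3 is the norm with both arguments 1.\<close>
    thus ?thesis by (intro exI[of _ 1]) simp
  next
    case False
    then obtain k :: int where "int (p i) = 6 * k + 1" using p[OF i] by blast
    hence "p i mod 3 = 1" by presburger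
    thus ?thesis using p[OF i] prime_eisenstein_norm by metis
  qed
  then obtain x y :: int where "(\<Prod>i=1..r. int (p i)) = x\<^sup>2 + x * y + y\<^sup>2"
    using prod_eisenstein_norm[of "{1..r}" "\<lambda>i. int (p i)"] by auto
  hence xy: "real (\<Prod>i=1..r. p i) = real_of_int x ^ 2 + real_of_int x * real_of_int y + real_of_int y ^ 2"
    by (metis of_int_add of_int_mult of_int_of_nat_eq of_int_power of_nat_prod)
  have "\<theta>\<^sup>2 = l\<^sup>2 * real (\<Prod>i=1..r. p i)"
    unfolding th power_mult_distrib by (subst real_sqrt_pow2) (rule of_nat_0_le_iff, rule refl)
  thus "good \<theta>"
    unfolding xy by (intro good_if_eisenstein_norm[OF assms(1) l, of "of_int x" "of_int y"]) auto
qed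

end
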